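(* Let $k\ge 2$, $s\ge 1$, $\alpha\in(0,1)$, $\theta_\ell>1$ for $\ell=1,\dots,s$, and let $T_\ell^{(1)}=\{h_{\ell,1}^{(1)}<\dots<h_{\ell,d_\ell^{(1)}}^{(1)}\}\subset(0,1)$ be the finite set of all thresholds on constraint $\ell$. Suppose the $k$ systems produce Bernoulli observations as described in the context, either simulated independently or with common random numbers (CRN), with $\beta$ set correspondingly, and with $(\beta_\ell)_{\ell=1}^s$ set by either choice (i) or choice (ii) of the context. Then the single-pass procedure $\mathcal{BRF}$ guarantees $$\mathrm{PCD}=\Pr\Big(\bigcap_{i=1}^k\bigcap_{\ell=1}^s\bigcap_{h\in T_\ell^{(1)}}\mathrm{CD}_{i\ell}(h)\Big)\ \ge\ 1-\alpha .$$
   Context: Data. For each system $i\in\{1,\dots,k\}$, the vectors $(Y_{i1n},\dots,Y_{isn})$, $n=1,2,\dots$, are i.i.d. in $n$, and $Y_{i\ell n}\in\{0,1\}$ is Bernoulli with success probability $p_{i\ell}\in(0,1)$. Dependence between $Y_{i\ell n}$ and $Y_{i\ell' n}$ for $\ell\ne\ell'$ (same $i,n$) is arbitrary. For each system $i$, $U_{i1},U_{i2},\dots$ are i.i.d. uniform on $(0,1)$, independent of all observations $(Y_{i\ell n})_{\ell,n}$ of system $i$. For a threshold $h\in(0,1)$ the dummy Bernoulli variables are $I_{in}(h)=1$ if $U_{in}\le h$ and $0$ otherwise (the same $U_{in}$ is used for all thresholds and all constraints). Two sampling modes. Independent simulation: the families $\big((Y_{i\ell n})_{\ell,n},(U_{in})_n\big)$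 are independent across $i$; then $\beta=1-(1-\alpha)^{1/k}$. CRN: dependence across systems $i$ is arbitrary (for instance $U_{in}=U_n$ for all $i$ is allowed); then $\beta=\alpha/k$. Error allocation. All thresholds are included in one single pass, and $d_\ell^{(1)}$ is the number of thresholds on constraint $\ell$. Either (i) $\beta_\ell=\beta/s$ if $d_\ell^{(1)}=1$ and $\beta_\ell=\beta/(2s)$ if $d_\ell^{(1)}>1$; or (ii) $\beta_\ell=\beta/D$ for all $\ell$, with $D=\sum_{\ell=1}^s\min\{d_\ell^{(1)},2\}$. $H_\ell$ is the smallest positive integer such that $\beta_\ell\ge 1/(1+\theta_\ell^{H_\ell})$. ($\beta_\ell$ and $H_\ell$ are only needed for constraints with $d_\ell^{(1)}\ge1$; an intersection over an empty threshold set is the whole sample space.) Procedure $\mathcal{BRF}$. For each $i$, $\ell$ and $h\in T_\ell^{(1)}$, consider $S_{i\ell}(r;h)=\sum_{n=1}^r\big(Y_{i\ell n}-I_{in}(h)\big)$, $r=1,2,\dots$. At the first $r$ for which $S_{i\ell}(r;h)\notin(-H_\ell,H_\ell)$, system $i$ is declared feasible for $h$ on constraint $\ell$ if $S_{i\ell}(r;h)\le-H_\ell$, and infeasible if $S_{i\ell}(r;h)\ge H_\ell$. Correct decision. System $i$ is desirable for $h$ on constraint $\ell$ if $\frac{(1-p_{i\ell})h}{p_{i\ell}(1-h)}\ge\theta_\ell$, unacceptable if $\frac{p_{i\ell}(1-h)}{(1-p_{i\ell})h}\ge\theta_\ell$, and acceptable otherwise. $\mathrm{CD}_{i\ell}(h)$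 is the event that system $i$ is declared feasible for $h$ on constraint $\ell$ if it is desirable, the event that it is declared infeasible if it is unacceptable, and the sure event if it is acceptable (any decision is then correct). *)

theory Defs
  imports "HOL-Probability.Probability"
begin

text \<open>Observations are modelled as Booleans, \<open>True\<close> being the outcome 1, so that the library's
  \<open>bernoulli_pmf\<close> applies. Systems, constraints and observation times are numbered from 1.
  The argument order is \<open>Y i l n \<omega>\<close> (system, constraint, time) and \<open>U i n \<omega>\<close>.\<close>

abbreviation obs_vec_space :: "nat \<Rightarrow> (nat \<Rightarrow> bool) measure" where
  "obs_vec_space s \<equiv> PiM {1..s} (\<lambda>_. count_space UNIV)"

definition obs_vec :: "nat \<Rightarrow> (nat \<Rightarrow> nat \<Rightarrow> 'a \<Rightarrow> bool) \<Rightarrow> nat \<Rightarrow> 'a \<Rightarrow> nat \<Rightarrow> bool" where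
  "obs_vec s Yi n \<omega> = (\<lambda>l\<in>{1..s}. Yi l n \<omega>)"

abbreviation obs_space :: "nat \<Rightarrow> (nat \<times> nat \<Rightarrow> bool) measure" where
  "obs_space s \<equiv> PiM ({1..s} \<times> {1..}) (\<lambda>_. count_space UNIV)"

definition all_obs :: "nat \<Rightarrow> (nat \<Rightarrow> nat \<Rightarrow> 'a \<Rightarrow> bool) \<Rightarrow> 'a \<Rightarrow> nat \<times> nat \<Rightarrow> bool" where
  "all_obs s Yi \<omega> = restrict (\<lambda>(l, n). Yi l n \<omega>) ({1..s} \<times> {1..})"

abbreviation uniforms_space :: "(nat \<Rightarrow> real) measure" where
  "uniforms_space \<equiv> PiM {1..} (\<lambda>_. borel)"

definition all_uniforms :: "(nat \<Rightarrow> 'a \<Rightarrow> real) \<Rightarrow> 'a \<Rightarrow> nat \<Rightarrow> real" where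
  "all_uniforms Ui \<omega> = (\<lambda>n\<in>{1..}. Ui n \<omega>)"

text \<open>Independence of the uniforms from the observations is stated through the generated
  \<open>\<sigma>\<close>-algebras, because \<open>indep_var\<close> requires both variables to have the same type.\<close>

definition system_model ::
  "'a measure \<Rightarrow> nat \<Rightarrow> (nat \<Rightarrow> real) \<Rightarrow> (nat \<Rightarrow> nat \<Rightarrow> 'a \<Rightarrow> bool) \<Rightarrow> (nat \<Rightarrow> 'a \<Rightarrow> real) \<Rightarrow> bool"
where
  "system_model M s q Yi Ui \<longleftrightarrow>
     prob_space.indep_vars M (\<lambda>_. obs_vec_space s) (obs_vec s Yi) {1..} \<and>
     (\<forall>n\<ge>1. distr M (obs_vec_space s) (obs_vec s Yi n) =
             distr M (obs_vec_space s) (obs_vec s Yi 1)) \<and>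
     (\<forall>l\<in>{1..s}. \<forall>n\<ge>1. distr M (count_space UNIV) (Yi l n) = measure_pmf (bernoulli_pmf (q l))) \<and>
     prob_space.indep_vars M (\<lambda>_. borel) Ui {1..} \<and>
     (\<forall>n\<ge>1. distr M borel (Ui n) = uniform_measure lborel {0<..<1}) \<and>
     prob_space.indep_set M
       (sets (vimage_algebra (space M) (all_obs s Yi) (obs_space s)))
       (sets (vimage_algebra (space M) (all_uniforms Ui) uniforms_space))"

definition independent_systems ::
  "'a measure \<Rightarrow> nat \<Rightarrow> nat \<Rightarrow> (nat \<Rightarrow> nat \<Rightarrow> nat \<Rightarrow> 'a \<Rightarrow> bool) \<Rightarrow> (nat \<Rightarrow> nat \<Rightarrow> 'a \<Rightarrow> real) \<Rightarrow> bool"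
where
  "independent_systems M k s Y U \<longleftrightarrow>
     prob_space.indep_vars M (\<lambda>_. obs_space s \<Otimes>\<^sub>M uniforms_space)
       (\<lambda>i \<omega>. (all_obs s (Y i) \<omega>, all_uniforms (U i) \<omega>)) {1..k}"

text \<open>Both allocations leave the error unconstrained where there are no thresholds.\<close>

definition equal_allocation ::
  "nat \<Rightarrow> (nat \<Rightarrow> real set) \<Rightarrow> real \<Rightarrow> (nat \<Rightarrow> real) \<Rightarrow> bool" where
  "equal_allocation s T \<beta> \<beta>l \<longleftrightarrow>
     (\<forall>l\<in>{1..s}. (card (T l) = 1 \<longrightarrow> \<beta>l l = \<beta> / real s) \<and>
                 (card (T l) > 1 \<longrightarrow> \<beta>l l = \<beta> / (2 * real s)))"

definition proportional_allocation ::
  "nat \<Rightarrow> (nat \<Rightarrow> real set) \<Rightarrow> real \<Rightarrow> (nat \<Rightarrow> real) \<Rightarrow> bool" where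
  "proportional_allocation s T \<beta> \<beta>l \<longleftrightarrow>
     (\<forall>l\<in>{1..s}. card (T l) \<ge> 1 \<longrightarrow> \<beta>l l = \<beta> / real (\<Sum>m=1..s. min (card (T m)) 2))"

definition boundary :: "real \<Rightarrow> real \<Rightarrow> nat" where
  "boundary b \<theta> = (LEAST H. H > 0 \<and> b \<ge> 1 / (1 + \<theta> ^ H))"

definition dummy :: "real \<Rightarrow> real \<Rightarrow> int" where
  "dummy u h = (if u \<le> h then 1 else 0)"

definition walk :: "(nat \<Rightarrow> bool) \<Rightarrow> (nat \<Rightarrow> real) \<Rightarrow> real \<Rightarrow> nat \<Rightarrow> int" where
  "walk y u h r = (\<Sum>n=1..r. of_bool (y n) - dummy (u n) h)"

definition first_exit :: "nat \<Rightarrow> (nat \<Rightarrow> int) \<Rightarrow> nat \<Rightarrow> bool" where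
  "first_exit H S r \<longleftrightarrow>
     r \<ge> 1 \<and> S r \<notin> {- int H<..<int H} \<and> (\<forall>q\<in>{1..<r}. S q \<in> {- int H<..<int H})"

text \<open>On a path that never leaves the interval neither declaration is made.\<close>

definition declared_feasible :: "nat \<Rightarrow> (nat \<Rightarrow> int) \<Rightarrow> bool" where
  "declared_feasible H S \<longleftrightarrow> (\<exists>r. first_exit H S r \<and> S r \<le> - int H)"

definition declared_infeasible :: "nat \<Rightarrow> (nat \<Rightarrow> int) \<Rightarrow> bool" where
  "declared_infeasible H S \<longleftrightarrow> (\<exists>r. first_exit H S r \<and> S r \<ge> int H)"

definition desirable :: "real \<Rightarrow> real \<Rightarrow> real \<Rightarrow> bool" where
  "desirable \<theta> p h \<longleftrightarrow> ((1 - p) * h) / (p * (1 - h)) \<ge> \<theta>"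

definition unacceptable :: "real \<Rightarrow> real \<Rightarrow> real \<Rightarrow> bool" where
  "unacceptable \<theta> p h \<longleftrightarrow> (p * (1 - h)) / ((1 - p) * h) \<ge> \<theta>"

text \<open>The first two cases exclude each other when \<open>\<theta> > 1\<close>, so their order is immaterial.\<close>

definition CD ::
  "'a measure \<Rightarrow> real \<Rightarrow> nat \<Rightarrow> real \<Rightarrow> (nat \<Rightarrow> 'a \<Rightarrow> bool) \<Rightarrow> (nat \<Rightarrow> 'a \<Rightarrow> real) \<Rightarrow> real \<Rightarrow> 'a set"
where
  "CD M \<theta> H p Yil Ui h =
     (if desirable \<theta> p h then
        {\<omega> \<in> space M. declared_feasible H (walk (\<lambda>n. Yil n \<omega>) (\<lambda>n. Ui n \<omega>) h)}
      else if unacceptable \<theta> p h then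
        {\<omega> \<in> space M. declared_infeasible H (walk (\<lambda>n. Yil n \<omega>) (\<lambda>n. Ui n \<omega>) h)}
      else space M)"

text \<open>The intersection with \<open>space M\<close> matters only when there are no thresholds at all, since
  an empty intersection of sets is \<open>UNIV\<close>.\<close>

definition PCD ::
  "'a measure \<Rightarrow> nat \<Rightarrow> nat \<Rightarrow> (nat \<Rightarrow> real set) \<Rightarrow> (nat \<Rightarrow> real) \<Rightarrow> (nat \<Rightarrow> nat) \<Rightarrow>
   (nat \<Rightarrow> nat \<Rightarrow> real) \<Rightarrow> (nat \<Rightarrow> nat \<Rightarrow> nat \<Rightarrow> 'a \<Rightarrow> bool) \<Rightarrow> (nat \<Rightarrow> nat \<Rightarrow> 'a \<Rightarrow> real) \<Rightarrow> real"
where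
  "PCD M k s T \<theta> H p Y U =
     measure M (space M \<inter>
       (\<Inter>i\<in>{1..k}. \<Inter>l\<in>{1..s}. \<Inter>h\<in>T l. CD M (\<theta> l) (H l) (p i l) (Y i l) (U i) h))"

end

theory Submission
  imports Defs
begin

text \<open>
  On a constraint \<open>l\<close>, a system is tested against the threshold \<open>h\<close> by the walk of differences
  between its observations and dummy successes of probability \<open>h\<close>. For a desirable system this
  walk goes down at least \<open>\<theta>\<close> times as often as up, and the gambler's ruin formula bounds the
  probability of a wrong exit from \<open>(- H, H)\<close> by \<open>1 / (1 + \<theta> ^ H)\<close>, which is at most the error
  allocated to the constraint by the choice of \<open>H\<close>. This is \<open>prob_declared_feasible_ge\<close>. Its proof
  stays within a finite number of steps: the exponential martingale controls the probability of
  having left at the top, Wald's identity controls the probability of not having left at all, and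
  the latter disappears in the limit. Unacceptable systems are the mirror image.

  A union bound over all thresholds would be too expensive. Since all thresholds use the same
  uniforms, the walks are ordered: a larger threshold has a lower path, and a lower path exits at the
  bottom whenever a higher path does (\<open>declared_feasible_mono\<close>). Hence only the smallest desirable
  and the largest unacceptable threshold of a constraint can cause an error
  (\<open>two_thresholds_decide\<close>), and a union bound over them and over the constraints gives an error of at
  most \<open>\<beta>\<close> per system, whatever the dependence between the constraints is
  (\<open>prob_all_correct_ge\<close>).

  Under arbitrary dependence of the systems, the union bound gives the total error
  \<open>k * \<beta> = \<alpha>\<close>. If the systems are independent, the probabilities of being correct multiply to at
  least \<open>(1 - \<beta>) ^ k = 1 - \<alpha>\<close>.
\<close>

section \<open>Union bound and exit decisions\<close>

text \<open>Bonferroni's inequality. It is applied three times: over the thresholds that matter on one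
  constraint, over the constraints of one system, and, for common random numbers, over the systems.\<close>

lemma (in prob_space) prob_Ball_ge:
  assumes "finite I" and events: "\<And>i. i \<in> I \<Longrightarrow> {\<omega> \<in> space M. P i \<omega>} \<in> events"
    and prob: "\<And>i. i \<in> I \<Longrightarrow> prob {\<omega> \<in> space M. P i \<omega>} \<ge> 1 - e i"
  shows "prob {\<omega> \<in> space M. \<forall>i\<in>I. P i \<omega>} \<ge> 1 - (\<Sum>i\<in>I. e i)"
proof -
  let ?G = "\<lambda>i. {\<omega> \<in> space M. P i \<omega>}"
  have G: "{\<omega> \<in> space M. \<forall>i\<in>I. P i \<omega>} \<in> events"
    using events \<open>finite I\<close> by (intro sets.sets_Collect_finite_All) auto
  have "prob (space M - {\<omega> \<in> space M. \<forall>i\<in>I. P i \<omega>}) = prob (\<Union>i\<in>I. space M - ?G i)"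
    by (rule arg_cong[where f = prob]) auto
  also have "\<dots> \<le> (\<Sum>i\<in>I. prob (space M - ?G i))"
    using events \<open>finite I\<close> by (intro measure_UNION_le) auto
  also have "\<dots> \<le> (\<Sum>i\<in>I. e i)"
  proof (rule sum_mono)
    fix i assume "i \<in> I"
    then show "prob (space M - ?G i) \<le> e i"
      using prob_compl[OF events] prob by force
  qed
  finally show ?thesis
    using prob_compl[OF G] by simp
qed

lemma measurable_countable_binop:
  fixes f :: "'a \<Rightarrow> 'b::countable" and g :: "'a \<Rightarrow> 'c::countable"
  assumes f: "f \<in> N \<rightarrow>\<^sub>M count_space UNIV" and g: "g \<in> N \<rightarrow>\<^sub>M count_space UNIV"
  shows "(\<lambda>x. F (f x) (g x)) \<in> N \<rightarrow>\<^sub>M count_space UNIV"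
proof (rule measurable_compose_countable[OF _ f])
  fix i
  show "(\<lambda>x. F i (g x)) \<in> N \<rightarrow>\<^sub>M count_space UNIV"
    using g by (rule measurable_compose) simp
qed

lemma pred_declared_feasible:
  assumes S: "\<And>r. (\<lambda>\<omega>. S \<omega> r) \<in> N \<rightarrow>\<^sub>M count_space UNIV"
  shows "Measurable.pred N (\<lambda>\<omega>. declared_feasible H (S \<omega>))"
proof -
  have atom: "Measurable.pred N (\<lambda>\<omega>. P (S \<omega> r))" for P r
    by (rule measurable_compose[OF S]) simp
  show ?thesis
    unfolding declared_feasible_def first_exit_def
    by (intro pred_intros_countable pred_intros_logic pred_intros_countable_bounded
        atom[of "\<lambda>z. z \<in> {- int H<..<int H}"] atom[of "\<lambda>z. z \<notin> {- int H<..<int H}"]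
        atom[of "\<lambda>z. z \<le> - int H"]) auto
qed

lemma first_exit_uminus: "first_exit H (\<lambda>r. - S r) r \<longleftrightarrow> first_exit H S r"
  unfolding first_exit_def by auto

text \<open>The two decisions are mirror images under reflection of the path, so exit properties
  and error bounds are only proved for the lower boundary.\<close>

lemma declared_infeasible_iff_feasible_uminus:
  "declared_infeasible H S \<longleftrightarrow> declared_feasible H (\<lambda>r. - S r)"
  unfolding declared_infeasible_def declared_feasible_def first_exit_uminus
  by (auto simp: le_minus_iff)

text \<open>A path below another one cannot be stopped at the upper boundary first: while the upper path
  is still inside, the lower one is under \<open>H\<close>, and at the upper path's exit it is at or
  under \<open>- H\<close>. So its own first exit comes no later and is at the bottom.\<close>

lemma declared_feasible_mono:
  assumes "declared_feasible H S" and le: "\<And>r. S' r \<le> S r"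
  shows "declared_feasible H S'"
proof -
  obtain r where r: "first_exit H S r" "S r \<le> - int H"
    using assms(1) unfolding declared_feasible_def by auto
  let ?P = "\<lambda>q. q \<ge> 1 \<and> S' q \<notin> {- int H<..<int H}"
  define q where "q = (LEAST q. ?P q)"
  have Pr: "?P r"
    using r le[of r] unfolding first_exit_def by auto
  have Pq: "?P q" and "q \<le> r"
    using LeastI[of ?P, OF Pr] Least_le[of ?P, OF Pr] by (simp_all add: q_def)
  have "\<not> ?P m" if "m < q" for m
    using not_less_Least[of m ?P] that by (simp add: q_def)
  then have "first_exit H S' q"
    unfolding first_exit_def using Pq by auto
  moreover have "S' q \<le> - int H"
  proof (cases "q = r")
    case True
    then show ?thesis using r le[of r] by simp
  next
    case False
    then have "S q \<in> {- int H<..<int H}"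
      using r Pq \<open>q \<le> r\<close> unfolding first_exit_def by auto
    then show ?thesis using Pq le[of q] by auto
  qed
  ultimately show ?thesis
    unfolding declared_feasible_def by auto
qed

lemma declared_infeasible_mono:
  assumes "declared_infeasible H S" and "\<And>r. S r \<le> S' r"
  shows "declared_infeasible H S'"
  using assms unfolding declared_infeasible_iff_feasible_uminus
  by (auto intro: declared_feasible_mono)

section \<open>Gambler's ruin for a lazy walk with drift\<close>

text \<open>The path of partial sums of \<open>x\<close>, frozen at its first exit from \<open>{- H<..<H}\<close>. Because
  it is frozen, it stays bounded and can be analysed one step at a time over a fixed number of steps.\<close>

primrec stopped_walk :: "nat \<Rightarrow> (nat \<Rightarrow> int) \<Rightarrow> nat \<Rightarrow> int" where
  "stopped_walk H x 0 = 0"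
| "stopped_walk H x (Suc n) = stopped_walk H x n +
     (if \<bar>stopped_walk H x n\<bar> < int H then x (Suc n) else 0)"

lemma abs_stopped_walk_le:
  assumes "\<And>n. n \<ge> 1 \<Longrightarrow> \<bar>x n\<bar> \<le> 1"
  shows "\<bar>stopped_walk H x n\<bar> \<le> int H"
proof (induction n)
  case (Suc n)
  then show ?case using assms[of "Suc n"] by auto
qed simp

text \<open>Being frozen loses nothing: until the first exit the frozen walk is the walk itself, and
  afterwards its value is the walk's value at that exit, which determines the decision.\<close>

lemma stopped_walk_cases:
  fixes x :: "nat \<Rightarrow> int"
  assumes "H > 0"
  defines "S \<equiv> \<lambda>r. \<Sum>n=1..r. x n"
  shows "(\<forall>q\<le>n. \<bar>S q\<bar> < int H) \<and> stopped_walk H x n = S n \<or>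
         (\<exists>r. first_exit H S r \<and> stopped_walk H x n = S r)"
proof (induction n)
  case 0
  then show ?case using assms by auto
next
  case (Suc n)
  have S_Suc: "S (Suc n) = S n + x (Suc n)"
    by (simp add: S_def)
  from Suc show ?case
  proof
    assume inside: "(\<forall>q\<le>n. \<bar>S q\<bar> < int H) \<and> stopped_walk H x n = S n"
    then have eq: "stopped_walk H x (Suc n) = S (Suc n)"
      using S_Suc by simp
    show ?thesis
    proof (cases "\<bar>S (Suc n)\<bar> < int H")
      case True
      then show ?thesis using inside eq by (auto simp: le_Suc_eq)
    next
      case False
      have "S q \<in> {- int H<..<int H}" if "q \<le> n" for q
        using inside that by (auto simp: abs_less_iff dest!: spec[of _ q])
      then have "first_exit H S (Suc n)"
        unfolding first_exit_def using False by (auto simp: abs_less_iff)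
      then show ?thesis using eq by blast
    qed
  next
    assume "\<exists>r. first_exit H S r \<and> stopped_walk H x n = S r"
    then show ?thesis
      unfolding first_exit_def by (auto simp: abs_less_iff)
  qed
qed

lemma declared_feasible_if_stopped_walk:
  assumes "H > 0" and "stopped_walk H x n = - int H"
  shows "declared_feasible H (\<lambda>r. \<Sum>n=1..r. x n)"
  using stopped_walk_cases[OF assms(1), of n x] assms(2)
  unfolding declared_feasible_def by auto

lemma measurable_stopped_walk:
  assumes "{1..n} \<subseteq> I"
  shows "(\<lambda>x. stopped_walk H x n) \<in> PiM I (\<lambda>_. count_space UNIV) \<rightarrow>\<^sub>M count_space UNIV"
  using assms
proof (induction n)
  case (Suc n)
  have "(\<lambda>x. stopped_walk H x n) \<in> PiM I (\<lambda>_. count_space UNIV) \<rightarrow>\<^sub>M count_space UNIV"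
    using Suc.prems by (intro Suc.IH) auto
  moreover have "(\<lambda>x. x (Suc n)) \<in> PiM I (\<lambda>_. count_space (UNIV::int set)) \<rightarrow>\<^sub>M count_space UNIV"
    using Suc.prems by (intro measurable_component_singleton) auto
  ultimately show ?case
    unfolding stopped_walk.simps
    by (rule measurable_countable_binop[where F = "\<lambda>z y. z + (if \<bar>z\<bar> < int H then y else 0)"])
qed simp

lemma stopped_walk_restrict:
  "{1..n} \<subseteq> I \<Longrightarrow> stopped_walk H (restrict x I) n = stopped_walk H x n"
  by (induction n) (auto simp: subset_eq)

text \<open>The walk may stand still with probability \<open>1 - a - b\<close>, as it does whenever an observation
  agrees with its dummy. Steps are numbered from 1, like observations.\<close>

locale lazy_random_walk = prob_space M for M :: "'a measure" +
  fixes X :: "nat \<Rightarrow> 'a \<Rightarrow> int" and a b :: real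
  assumes indep: "indep_vars (\<lambda>_. count_space UNIV) X {1..}"
    and range: "\<And>n \<omega>. n \<ge> 1 \<Longrightarrow> X n \<omega> \<in> {-1, 0, 1}"
    and prob_up: "\<And>n. n \<ge> 1 \<Longrightarrow> prob {\<omega> \<in> space M. X n \<omega> = 1} = a"
    and prob_down: "\<And>n. n \<ge> 1 \<Longrightarrow> prob {\<omega> \<in> space M. X n \<omega> = -1} = b"
begin

lemma X_measurable: "n \<ge> 1 \<Longrightarrow> X n \<in> M \<rightarrow>\<^sub>M count_space UNIV"
  using indep unfolding indep_vars_def by auto

definition stopped :: "nat \<Rightarrow> nat \<Rightarrow> 'a \<Rightarrow> int" where
  "stopped H n \<omega> = stopped_walk H (\<lambda>m. X m \<omega>) n"

lemma abs_X_le: "n \<ge> 1 \<Longrightarrow> \<bar>X n \<omega>\<bar> \<le> 1"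
  using range[of n \<omega>] by auto

lemma abs_stopped_le: "\<bar>stopped H n \<omega>\<bar> \<le> int H"
  unfolding stopped_def by (intro abs_stopped_walk_le abs_X_le)

text \<open>The frozen walk after \<open>n\<close> steps is a function of the steps up to \<open>n\<close>, hence independent of
  the next one. This lets expectations factor in the one-step recursions below.\<close>

lemma indep_stopped_X: "indep_var (count_space UNIV) (stopped H n) (count_space UNIV) (X (Suc n))"
proof -
  let ?C = "\<lambda>_. count_space (UNIV :: int set)"
  have "indep_var (PiM {1..n} ?C) (\<lambda>\<omega>. restrict (\<lambda>i. X i \<omega>) {1..n})
                  (PiM {Suc n} ?C) (\<lambda>\<omega>. restrict (\<lambda>i. X i \<omega>) {Suc n})"
    by (rule indep_var_restrict[OF indep]) auto
  then have "indep_var (count_space UNIV)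
      ((\<lambda>x. stopped_walk H x n) \<circ> (\<lambda>\<omega>. restrict (\<lambda>i. X i \<omega>) {1..n}))
      (count_space UNIV) ((\<lambda>x. x (Suc n)) \<circ> (\<lambda>\<omega>. restrict (\<lambda>i. X i \<omega>) {Suc n}))"
    by (rule indep_var_compose)
       (auto intro: measurable_stopped_walk measurable_component_singleton)
  moreover have "(\<lambda>x. stopped_walk H x n) \<circ> (\<lambda>\<omega>. restrict (\<lambda>i. X i \<omega>) {1..n}) = stopped H n"
    by (auto simp: fun_eq_iff stopped_def stopped_walk_restrict)
  moreover have "(\<lambda>x. x (Suc n)) \<circ> (\<lambda>\<omega>. restrict (\<lambda>i. X i \<omega>) {Suc n}) = X (Suc n)"
    by auto
  ultimately show ?thesis by simp
qed

lemma stopped_measurable: "stopped H n \<in> M \<rightarrow>\<^sub>M count_space UNIV"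
  using indep_stopped_X[of H n] unfolding indep_var_eq by auto

lemma integrable_bounded_int:
  fixes f :: "int \<Rightarrow> real"
  assumes "V \<in> M \<rightarrow>\<^sub>M count_space UNIV" and "\<And>\<omega>. \<bar>V \<omega>\<bar> \<le> c"
  shows "integrable M (\<lambda>\<omega>. f (V \<omega>))"
proof (rule integrable_const_bound)
  have "norm (f (V \<omega>)) \<le> (\<Sum>z\<in>{-c..c}. \<bar>f z\<bar>)" for \<omega>
    unfolding real_norm_def using assms(2)[of \<omega>] by (intro member_le_sum) auto
  then show "AE \<omega> in M. norm (f (V \<omega>)) \<le> (\<Sum>z\<in>{-c..c}. \<bar>f z\<bar>)" by simp
  show "(\<lambda>\<omega>. f (V \<omega>)) \<in> borel_measurable M"
    using assms(1) by (rule measurable_compose) simp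
qed

lemma expectation_stopped_times_X:
  fixes f g :: "int \<Rightarrow> real"
  shows "expectation (\<lambda>\<omega>. f (stopped H n \<omega>) * g (X (Suc n) \<omega>)) =
         expectation (\<lambda>\<omega>. f (stopped H n \<omega>)) * expectation (\<lambda>\<omega>. g (X (Suc n) \<omega>))"
    and "integrable M (\<lambda>\<omega>. f (stopped H n \<omega>) * g (X (Suc n) \<omega>))"
proof -
  have ind: "indep_var borel (\<lambda>\<omega>. f (stopped H n \<omega>)) borel (\<lambda>\<omega>. g (X (Suc n) \<omega>))"
    using indep_var_compose[OF indep_stopped_X, of f borel g borel] by (simp add: comp_def)
  have 1: "integrable M (\<lambda>\<omega>. f (stopped H n \<omega>))"
    by (rule integrable_bounded_int[OF stopped_measurable abs_stopped_le])
  have 2: "integrable M (\<lambda>\<omega>. g (X (Suc n) \<omega>))"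
    by (rule integrable_bounded_int[OF X_measurable abs_X_le]) auto
  show "expectation (\<lambda>\<omega>. f (stopped H n \<omega>) * g (X (Suc n) \<omega>)) =
         expectation (\<lambda>\<omega>. f (stopped H n \<omega>)) * expectation (\<lambda>\<omega>. g (X (Suc n) \<omega>))"
    by (rule indep_var_lebesgue_integral[OF ind 1 2])
  show "integrable M (\<lambda>\<omega>. f (stopped H n \<omega>) * g (X (Suc n) \<omega>))"
    by (rule indep_var_integrable[OF ind 1 2])
qed

lemma expectation_X:
  fixes g :: "int \<Rightarrow> real"
  assumes "n \<ge> 1"
  shows "expectation (\<lambda>\<omega>. g (X n \<omega>)) = a * g 1 + b * g (-1) + (1 - a - b) * g 0"
proof -
  let ?U = "{\<omega> \<in> space M. X n \<omega> = 1}" and ?D = "{\<omega> \<in> space M. X n \<omega> = -1}"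
  note [measurable] = X_measurable[OF assms]
  have "expectation (\<lambda>\<omega>. g (X n \<omega>)) = expectation (\<lambda>\<omega>. g 0 + (g 1 - g 0) * indicator ?U \<omega> +
          (g (-1) - g 0) * indicator ?D \<omega>)"
  proof (intro Bochner_Integration.integral_cong refl)
    fix \<omega> assume "\<omega> \<in> space M"
    then show "g (X n \<omega>) = g 0 + (g 1 - g 0) * indicator ?U \<omega> + (g (-1) - g 0) * indicator ?D \<omega>"
      using range[OF assms, of \<omega>] by (auto simp: indicator_def)
  qed
  also have "\<dots> = g 0 + (g 1 - g 0) * prob ?U + (g (-1) - g 0) * prob ?D"
    by (simp add: prob_space finite_measure.emeasure_finite less_top[symmetric])
  finally show ?thesis
    using prob_up[OF assms] prob_down[OF assms] by (simp add: algebra_simps)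
qed

lemma stopped_event: "{\<omega> \<in> space M. P (stopped H n \<omega>)} \<in> events"
proof -
  have "stopped H n -` {z. P z} \<inter> space M \<in> events"
    by (rule measurable_sets[OF stopped_measurable]) simp
  then show ?thesis by (simp add: vimage_def Int_def conj_commute)
qed

text \<open>For \<open>H > 0\<close>, this is the probability that no decision has been made within \<open>n\<close> steps.\<close>

definition prob_inside :: "nat \<Rightarrow> nat \<Rightarrow> real" where
  "prob_inside H n = prob {\<omega> \<in> space M. \<bar>stopped H n \<omega>\<bar> < int H}"

text \<open>Wald's identity at a bounded time: each step moves the mean by the drift \<open>a - b\<close>, but only on
  the event that the walk is still running.\<close>

lemma expectation_stopped: "expectation (\<lambda>\<omega>. real_of_int (stopped H n \<omega>)) = (a - b) * (\<Sum>m<n. prob_inside H m)"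
proof (induction n)
  case 0
  then show ?case by (simp add: stopped_def)
next
  case (Suc n)
  let ?f = "\<lambda>z. if \<bar>z\<bar> < int H then 1 else 0 :: real"
  note [measurable] = stopped_measurable
  have inside: "expectation (\<lambda>\<omega>. ?f (stopped H n \<omega>)) = prob_inside H n"
  proof -
    have "expectation (\<lambda>\<omega>. ?f (stopped H n \<omega>)) =
        expectation (\<lambda>\<omega>. indicator {\<omega> \<in> space M. \<bar>stopped H n \<omega>\<bar> < int H} \<omega>)"
      by (intro Bochner_Integration.integral_cong) (auto simp: indicator_def)
    then show ?thesis by (simp add: prob_inside_def Int_absorb2 subset_eq)
  qed
  have "expectation (\<lambda>\<omega>. real_of_int (stopped H (Suc n) \<omega>)) =
     expectation (\<lambda>\<omega>. real_of_int (stopped H n \<omega>) + ?f (stopped H n \<omega>) * real_of_int (X (Suc n) \<omega>))"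
    by (intro Bochner_Integration.integral_cong) (auto simp: stopped_def)
  also have "\<dots> = expectation (\<lambda>\<omega>. real_of_int (stopped H n \<omega>)) + prob_inside H n * (a - b)"
    using integrable_bounded_int[OF stopped_measurable abs_stopped_le, of real_of_int]
      expectation_stopped_times_X[of ?f H n real_of_int] inside expectation_X[of "Suc n" real_of_int]
    by (subst Bochner_Integration.integral_add) auto
  finally show ?case
    using Suc by (simp add: algebra_simps)
qed

lemma prob_inside_antimono: "m \<le> n \<Longrightarrow> prob_inside H n \<le> prob_inside H m"
proof (induction rule: dec_induct)
  case (step n)
  have "prob_inside H (Suc n) \<le> prob_inside H n"
    unfolding prob_inside_def
  proof (rule finite_measure_mono)
    show "{\<omega> \<in> space M. \<bar>stopped H (Suc n) \<omega>\<bar> < int H} \<subseteq> {\<omega> \<in> space M. \<bar>stopped H n \<omega>\<bar> < int H}"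
      by (auto simp: stopped_def split: if_splits)
  qed (rule stopped_event)
  with step show ?case by simp
qed simp

text \<open>With a negative drift, long survival would push the mean of the frozen walk below \<open>- H\<close>.
  Since survival probabilities decrease, the last of \<open>n\<close> of them is at most their average.\<close>

lemma prob_inside_le:
  assumes "a < b" and "n > 0"
  shows "prob_inside H n \<le> (real H / (b - a)) / real n"
proof -
  have "(b - a) * (real n * prob_inside H n) \<le> (b - a) * (\<Sum>m<n. prob_inside H m)"
    using assms prob_inside_antimono[of _ n H] sum_mono[of "{..<n}" "\<lambda>_. prob_inside H n" "prob_inside H"]
    by (intro mult_left_mono) auto
  also have "\<dots> = - expectation (\<lambda>\<omega>. real_of_int (stopped H n \<omega>))"
    using expectation_stopped[of H n] by (simp add: algebra_simps)
  also have "\<dots> = expectation (\<lambda>\<omega>. - real_of_int (stopped H n \<omega>))"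
    by simp
  also have "\<dots> \<le> expectation (\<lambda>\<omega>. real H)"
  proof (rule integral_mono)
    show "integrable M (\<lambda>\<omega>. - real_of_int (stopped H n \<omega>))"
      by (rule integrable_bounded_int[OF stopped_measurable abs_stopped_le])
    show "- real_of_int (stopped H n \<omega>) \<le> real H" for \<omega>
      using abs_stopped_le[of H n \<omega>] by linarith
  qed simp
  finally show ?thesis
    using assms by (simp add: prob_space field_simps)
qed

text \<open>The exponential martingale: \<open>\<rho> = b / a\<close> is the base for which one step multiplies
  \<open>\<rho> powi _\<close> by a factor of mean \<open>a * \<rho> + b / \<rho> + (1 - a - b) = 1\<close>.\<close>

lemma expectation_exponential:
  assumes "a > 0" "b > 0" and "\<rho> = b / a"
  shows "expectation (\<lambda>\<omega>. \<rho> powi stopped H n \<omega>) = 1"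
proof (induction n)
  case 0
  then show ?case by (simp add: stopped_def prob_space)
next
  case (Suc n)
  let ?f = "\<lambda>z. if \<bar>z\<bar> < int H then \<rho> powi z else 0"
  have "\<rho> > 0" using assms by simp
  have a: "b * inverse \<rho> = a" and b: "a * \<rho> = b" using assms by simp_all
  have "expectation (\<lambda>\<omega>. \<rho> powi stopped H (Suc n) \<omega>) =
     expectation (\<lambda>\<omega>. \<rho> powi stopped H n \<omega> + ?f (stopped H n \<omega>) * (\<rho> powi X (Suc n) \<omega> - 1))"
    using \<open>\<rho> > 0\<close>
    by (intro Bochner_Integration.integral_cong) (auto simp: stopped_def power_int_add algebra_simps)
  also have "\<dots> = 1 + expectation (\<lambda>\<omega>. ?f (stopped H n \<omega>)) *
                        expectation (\<lambda>\<omega>. \<rho> powi X (Suc n) \<omega> - 1)"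
    using integrable_bounded_int[OF stopped_measurable abs_stopped_le, of "\<lambda>z. \<rho> powi z"] Suc
      expectation_stopped_times_X[of ?f H n "\<lambda>x. \<rho> powi x - 1"]
    by (subst Bochner_Integration.integral_add) auto
  also have "expectation (\<lambda>\<omega>. \<rho> powi X (Suc n) \<omega> - 1) = 0"
    unfolding expectation_X[of "Suc n" "\<lambda>x. \<rho> powi x - 1", simplified]
    using a b by (simp add: algebra_simps)
  finally show ?case by simp
qed

text \<open>On \<open>{- H..H}\<close> the martingale is at least \<open>\<rho> ^ (- H)\<close> everywhere and \<open>\<rho> ^ H\<close> at the top.
  As its mean is 1, the top has probability at most
  \<open>(1 - \<rho> ^ (- H)) / (\<rho> ^ H - \<rho> ^ (- H)) = 1 / (1 + \<rho> ^ H)\<close>.\<close>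

lemma prob_hit_top_le:
  assumes "a > 0" "b > a" "\<rho> = b / a" and "H > 0"
  shows "prob {\<omega> \<in> space M. stopped H n \<omega> = int H} \<le> 1 / (1 + \<rho> ^ H)"
proof -
  let ?B = "{\<omega> \<in> space M. stopped H n \<omega> = int H}"
  note [measurable] = stopped_event
  have \<rho>: "\<rho> > 1" using assms by simp
  define c where "c = \<rho> ^ H"
  have c: "c > 1" using \<rho> \<open>H > 0\<close> by (simp add: c_def one_less_power)
  \<comment> \<open>\<open>(c - 1 / c) * indicator ?B + 1 / c\<close> is the smallest value of the martingale, raised to its
    actual value \<open>c\<close> on \<open>?B\<close>.\<close>
  have "(c - 1 / c) * prob ?B + 1 / c = expectation (\<lambda>\<omega>. (c - 1 / c) * indicator ?B \<omega> + 1 / c)"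
    by (simp add: prob_space finite_measure.emeasure_finite less_top[symmetric])
  also have "\<dots> \<le> expectation (\<lambda>\<omega>. \<rho> powi stopped H n \<omega>)"
  proof (rule integral_mono)
    show "integrable M (\<lambda>\<omega>. \<rho> powi stopped H n \<omega>)"
      by (rule integrable_bounded_int[OF stopped_measurable abs_stopped_le])
    fix \<omega> assume "\<omega> \<in> space M"
    have "\<rho> powi (- int H) \<le> \<rho> powi stopped H n \<omega>"
      using abs_stopped_le[of H n \<omega>] \<rho> by (intro power_int_increasing) auto
    then show "(c - 1 / c) * indicator ?B \<omega> + 1 / c \<le> \<rho> powi stopped H n \<omega>"
      by (auto simp: indicator_def c_def power_int_minus divide_inverse)
  qed (simp add: finite_measure.emeasure_finite less_top[symmetric])
  also have "\<dots> = 1"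
    using assms by (intro expectation_exponential) auto
  finally have "(c - 1 / c) * prob ?B \<le> 1 - 1 / c" by simp
  then have "c * ((c - 1 / c) * prob ?B) \<le> c * (1 - 1 / c)"
    using c by (intro mult_left_mono) auto
  also have "c * (1 - 1 / c) = (c - 1) * 1"
    using c by (simp add: field_simps)
  also have "c * ((c - 1 / c) * prob ?B) = (c - 1) * ((c + 1) * prob ?B)"
    using c by (simp add: field_simps)
  finally have "(c - 1) * ((c + 1) * prob ?B) \<le> (c - 1) * 1" .
  then have "(c + 1) * prob ?B \<le> 1"
    using c mult_le_cancel_left_pos[of "c - 1"] by simp
  then show ?thesis
    using c unfolding c_def[symmetric] by (simp add: field_simps)
qed

text \<open>If \<open>- H\<close> is not reached within \<open>n\<close> steps, the frozen walk is at \<open>H\<close> or still running. The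
  first event is bounded uniformly in \<open>n\<close> and the second vanishes as \<open>n\<close> grows, so paths that never
  exit contribute nothing to the error.\<close>

lemma prob_declared_feasible_ge:
  assumes "a > 0" "\<theta> > 1" "\<theta> * a \<le> b" and "H > 0"
  shows "prob {\<omega> \<in> space M. declared_feasible H (\<lambda>r. \<Sum>n=1..r. X n \<omega>)} \<ge> 1 - 1 / (1 + \<theta> ^ H)"
    (is "prob ?F \<ge> _")
proof -
  have "1 * a < \<theta> * a" using assms by (intro mult_strict_right_mono) auto
  with assms have "a < b" by linarith
  have meas_sum: "(\<lambda>\<omega>. \<Sum>n=1..r. X n \<omega>) \<in> M \<rightarrow>\<^sub>M count_space UNIV" for r
  proof (induction r)
    case (Suc r)
    have *: "(\<lambda>\<omega>. \<Sum>n=1..Suc r. X n \<omega>) = (\<lambda>\<omega>. (\<Sum>n=1..r. X n \<omega>) + X (Suc r) \<omega>)"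
      by simp
    have "X (Suc r) \<in> M \<rightarrow>\<^sub>M count_space UNIV"
      by (rule X_measurable) simp
    from measurable_countable_binop[OF Suc this, of "(+)"] show ?case
      unfolding * .
  qed simp
  have F: "?F \<in> events"
    using pred_declared_feasible[of "\<lambda>\<omega> r. \<Sum>n=1..r. X n \<omega>" M, OF meas_sum]
    unfolding pred_def .
  have bound: "prob (space M - ?F) \<le> 1 / (1 + \<theta> ^ H) + (real H / (b - a)) / real n" if "n > 0" for n
  proof -
    let ?B = "{\<omega> \<in> space M. stopped H n \<omega> = int H}" and ?C = "{\<omega> \<in> space M. \<bar>stopped H n \<omega>\<bar> < int H}"
    have "space M - ?F \<subseteq> ?B \<union> ?C"
    proof
      fix \<omega> assume \<omega>: "\<omega> \<in> space M - ?F"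
      then have "stopped H n \<omega> \<noteq> - int H"
        using declared_feasible_if_stopped_walk[OF \<open>H > 0\<close>, of "\<lambda>n. X n \<omega>" n]
        unfolding stopped_def by auto
      then show "\<omega> \<in> ?B \<union> ?C"
        using \<omega> abs_stopped_le[of H n \<omega>] by auto
    qed
    then have "prob (space M - ?F) \<le> prob (?B \<union> ?C)"
      by (intro finite_measure_mono sets.Un stopped_event)
    also have "\<dots> \<le> prob ?B + prob ?C"
      by (intro measure_Un_le stopped_event)
    also have "\<dots> \<le> 1 / (1 + (b / a) ^ H) + (real H / (b - a)) / real n"
      using prob_hit_top_le[of "b / a" H n] prob_inside_le[of n H] assms \<open>a < b\<close> that
      unfolding prob_inside_def by (intro add_mono) auto
    also have "1 / (1 + (b / a) ^ H) \<le> 1 / (1 + \<theta> ^ H)"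
    proof -
      have "\<theta> ^ H \<le> (b / a) ^ H"
        using assms by (intro power_mono) (auto simp: field_simps)
      moreover have "\<theta> ^ H > 0" using assms by simp
      ultimately show ?thesis by (intro divide_left_mono mult_pos_pos) auto
    qed
    finally show ?thesis by simp
  qed
  have "(\<lambda>n. 1 / (1 + \<theta> ^ H) + (real H / (b - a)) / real n) \<longlonglongrightarrow> 1 / (1 + \<theta> ^ H) + 0"
    by (intro tendsto_add tendsto_const lim_const_over_n)
  moreover have "\<exists>N. \<forall>n\<ge>N. prob (space M - ?F) \<le> 1 / (1 + \<theta> ^ H) + (real H / (b - a)) / real n"
    using bound by (intro exI[of _ 1]) auto
  ultimately have "prob (space M - ?F) \<le> 1 / (1 + \<theta> ^ H)"
    by (auto intro: LIMSEQ_le_const)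
  then show ?thesis
    using prob_compl[OF F] by simp
qed

end

lemma lazy_random_walk_uminus:
  assumes "lazy_random_walk M X a b"
  shows "lazy_random_walk M (\<lambda>n \<omega>. - X n \<omega>) b a"
proof -
  interpret lazy_random_walk M X a b by fact
  show ?thesis
  proof
    show "indep_vars (\<lambda>_. count_space UNIV) (\<lambda>n \<omega>. - X n \<omega>) {1..}"
      by (rule indep_vars_compose2[OF indep]) simp
    show "- X n \<omega> \<in> {-1, 0, 1}" if "n \<ge> 1" for n \<omega>
      using range[OF that, of \<omega>] by auto
    show "prob {\<omega> \<in> space M. - X n \<omega> = 1} = b" if "n \<ge> 1" for n
      using prob_down[OF that] by (simp add: minus_equation_iff[of _ 1] eq_commute)
    show "prob {\<omega> \<in> space M. - X n \<omega> = -1} = a" if "n \<ge> 1" for n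
      using prob_up[OF that] by simp
  qed
qed

section \<open>The walks of a single system\<close>

text \<open>If two sequences of independent variables are independent of each other, their pairs are
  independent. The two factors may live in different spaces, so the independence between the
  sequences is expressed by \<open>\<sigma>\<close>-algebras \<open>F\<close> and \<open>G\<close> that they are measurable for. On rectangles all
  probabilities factor, and the rectangles form an intersection-stable generator.\<close>

lemma (in prob_space) indep_vars_Pair_of_indep_families:
  assumes X: "indep_vars N X I" and Y: "indep_vars K Y I"
    and FG: "indep_set (sets F) (sets G)" "space F = space M" "space G = space M"
    and XF: "\<And>i. i \<in> I \<Longrightarrow> X i \<in> F \<rightarrow>\<^sub>M N i"
    and YG: "\<And>i. i \<in> I \<Longrightarrow> Y i \<in> G \<rightarrow>\<^sub>M K i"
  shows "indep_vars (\<lambda>i. N i \<Otimes>\<^sub>M K i) (\<lambda>i \<omega>. (X i \<omega>, Y i \<omega>)) I"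
  unfolding indep_vars_def2
proof (intro conjI ballI)
  let ?V = "\<lambda>i A. X i -` A \<inter> space M" and ?W = "\<lambda>i B. Y i -` B \<inter> space M"
  define E where "E i = {?V i A \<inter> ?W i B | A B. A \<in> sets (N i) \<and> B \<in> sets (K i)}" for i
  have Xm: "X i \<in> M \<rightarrow>\<^sub>M N i" and Ym: "Y i \<in> M \<rightarrow>\<^sub>M K i" if "i \<in> I" for i
    using X Y that unfolding indep_vars_def by auto
  show "(\<lambda>\<omega>. (X i \<omega>, Y i \<omega>)) \<in> M \<rightarrow>\<^sub>M N i \<Otimes>\<^sub>M K i" if "i \<in> I" for i
    using Xm[OF that] Ym[OF that] by (rule measurable_Pair)
  have "indep_sets E I"
  proof (rule indep_setsI)
    show "E i \<subseteq> events" if "i \<in> I" for i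
      unfolding E_def using Xm[OF that] Ym[OF that] by (auto intro: measurable_sets)
  next
    fix C J assume J: "J \<noteq> {}" "J \<subseteq> I" "finite J" "\<forall>j\<in>J. C j \<in> E j"
    then have "\<forall>j\<in>J. \<exists>A B. C j = ?V j A \<inter> ?W j B \<and> A \<in> sets (N j) \<and> B \<in> sets (K j)"
      unfolding E_def by auto
    then obtain A B where C: "\<And>j. j \<in> J \<Longrightarrow> C j = ?V j (A j) \<inter> ?W j (B j)"
      and A: "\<And>j. j \<in> J \<Longrightarrow> A j \<in> sets (N j)" and B: "\<And>j. j \<in> J \<Longrightarrow> B j \<in> sets (K j)"
      by metis
    have VF: "?V j (A j) \<in> sets F" if "j \<in> J" for j
      using measurable_sets[OF XF A] J that FG by auto
    have WG: "?W j (B j) \<in> sets G" if "j \<in> J" for j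
      using measurable_sets[OF YG B] J that FG by auto
    have "(\<Inter>j\<in>J. C j) = (\<Inter>j\<in>J. ?V j (A j)) \<inter> (\<Inter>j\<in>J. ?W j (B j))"
      using C by auto
    also have "prob \<dots> = prob (\<Inter>j\<in>J. ?V j (A j)) * prob (\<Inter>j\<in>J. ?W j (B j))"
      using VF WG J by (intro indep_setD[OF FG(1)] sets.finite_INT) auto
    also have "\<dots> = (\<Prod>j\<in>J. prob (?V j (A j)) * prob (?W j (B j)))"
      using indep_varsD[OF X, of J A] indep_varsD[OF Y, of J B] J A B
      by (simp add: prod.distrib)
    also have "\<dots> = (\<Prod>j\<in>J. prob (C j))"
      using VF WG C indep_setD[OF FG(1)] by (intro prod.cong) auto
    finally show "prob (\<Inter>j\<in>J. C j) = (\<Prod>j\<in>J. prob (C j))" .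
  qed
  moreover have "Int_stable (E i)" for i
  proof (rule Int_stableI)
    fix a b assume "a \<in> E i" "b \<in> E i"
    then obtain A B A' B' where "a = ?V i A \<inter> ?W i B" "b = ?V i A' \<inter> ?W i B'"
      and "A \<in> sets (N i)" "B \<in> sets (K i)" "A' \<in> sets (N i)" "B' \<in> sets (K i)"
      unfolding E_def by auto
    then have "a \<inter> b = ?V i (A \<inter> A') \<inter> ?W i (B \<inter> B')" "A \<inter> A' \<in> sets (N i)" "B \<inter> B' \<in> sets (K i)"
      by auto
    then show "a \<inter> b \<in> E i"
      unfolding E_def by blast
  qed
  ultimately have "indep_sets (\<lambda>i. sigma_sets (space M) (E i)) I"
    by (intro indep_sets_sigma) auto
  then show "indep_sets (\<lambda>i. {(\<lambda>\<omega>. (X i \<omega>, Y i \<omega>)) -` A \<inter> space M |A. A \<in> sets (N i \<Otimes>\<^sub>M K i)}) I"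
  proof (rule indep_sets_mono_sets)
    fix i assume "i \<in> I"
    let ?Z = "\<lambda>\<omega>. (X i \<omega>, Y i \<omega>)"
    let ?R = "{a \<times> b | a b. a \<in> sets (N i) \<and> b \<in> sets (K i)}"
    have "?Z \<in> space M \<rightarrow> space (N i) \<times> space (K i)"
      using measurable_space[OF Xm[OF \<open>i \<in> I\<close>]] measurable_space[OF Ym[OF \<open>i \<in> I\<close>]] by auto
    then have "{?Z -` A \<inter> space M |A. A \<in> sets (N i \<Otimes>\<^sub>M K i)} =
        sigma_sets (space M) {?Z -` A \<inter> space M |A. A \<in> ?R}"
      unfolding sets_pair_measure by (rule sigma_sets_vimage_commute)
    also have "{?Z -` A \<inter> space M |A. A \<in> ?R} \<subseteq> E i"
    proof clarify
      fix a b assume "a \<in> sets (N i)" "b \<in> sets (K i)"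
      moreover have "?Z -` (a \<times> b) \<inter> space M = ?V i a \<inter> ?W i b" by auto
      ultimately show "?Z -` (a \<times> b) \<inter> space M \<in> E i" unfolding E_def by blast
    qed
    then have "sigma_sets (space M) {?Z -` A \<inter> space M |A. A \<in> ?R} \<subseteq> sigma_sets (space M) (E i)"
      by (rule sigma_sets_mono')
    finally show "{?Z -` A \<inter> space M |A. A \<in> sets (N i \<Otimes>\<^sub>M K i)} \<subseteq> sigma_sets (space M) (E i)" .
  qed
qed

lemma measure_uniform_atMost:
  assumes "0 < h" "h < (1::real)"
  shows "measure (uniform_measure lborel {0<..<1}) {..h} = h"
proof -
  have "{0<..<1} \<inter> {..h} = {0<..h}" using assms by auto
  then show ?thesis
    using assms by (simp add: measure_uniform_measure)
qed

lemma measurable_dummy: "(\<lambda>u. dummy u h) \<in> borel \<rightarrow>\<^sub>M count_space UNIV"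
  unfolding dummy_def by measurable

lemma (in prob_space) system_measurable:
  assumes model: "system_model M s q Yi Ui"
  shows "l \<in> {1..s} \<Longrightarrow> n \<ge> 1 \<Longrightarrow> Yi l n \<in> M \<rightarrow>\<^sub>M count_space UNIV"
    and "n \<ge> 1 \<Longrightarrow> Ui n \<in> M \<rightarrow>\<^sub>M borel"
proof -
  assume l: "l \<in> {1..s}" and n: "n \<ge> 1"
  have "obs_vec s Yi n \<in> M \<rightarrow>\<^sub>M obs_vec_space s"
    using model n unfolding system_model_def indep_vars_def by auto
  then have "(\<lambda>\<omega>. obs_vec s Yi n \<omega> l) \<in> M \<rightarrow>\<^sub>M count_space UNIV"
    by (rule measurable_compose) (rule measurable_component_singleton[OF l])
  then show "Yi l n \<in> M \<rightarrow>\<^sub>M count_space UNIV"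
    using l by (simp add: obs_vec_def)
next
  show "Ui n \<in> M \<rightarrow>\<^sub>M borel" if "n \<ge> 1"
    using model that unfolding system_model_def indep_vars_def by auto
qed

text \<open>The observation is compared with an independent dummy of success probability \<open>h\<close>: the walk goes
  up on a success against a failure and down on a failure against a success. The quotient of the two
  probabilities is the odds ratio in the definition of desirable and unacceptable systems.\<close>

lemma (in prob_space) lazy_random_walk_system:
  assumes model: "system_model M s q Yi Ui" and l: "l \<in> {1..s}" and h: "0 < h" "h < 1"
    and q: "0 < q l" "q l < 1"
  shows "lazy_random_walk M (\<lambda>n \<omega>. of_bool (Yi l n \<omega>) - dummy (Ui n \<omega>) h)
           (q l * (1 - h)) ((1 - q l) * h)"
proof -
  define F where "F = vimage_algebra (space M) (all_obs s Yi) (obs_space s)"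
  define G where "G = vimage_algebra (space M) (all_uniforms Ui) uniforms_space"
  have FG: "indep_set (sets F) (sets G)" "space F = space M" "space G = space M"
    using model by (auto simp: system_model_def F_def G_def)
  have YF: "Yi l n \<in> F \<rightarrow>\<^sub>M count_space UNIV" if "n \<ge> 1" for n
  proof -
    have "all_obs s Yi \<in> F \<rightarrow>\<^sub>M obs_space s"
      unfolding F_def by (rule measurable_vimage_algebra1) (auto simp: space_PiM all_obs_def)
    then have "(\<lambda>\<omega>. all_obs s Yi \<omega> (l, n)) \<in> F \<rightarrow>\<^sub>M count_space UNIV"
      by (rule measurable_compose) (use l that in \<open>auto intro!: measurable_component_singleton\<close>)
    then show ?thesis
      using l that by (simp add: all_obs_def)
  qed
  have UG: "Ui n \<in> G \<rightarrow>\<^sub>M borel" if "n \<ge> 1" for n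
  proof -
    have "all_uniforms Ui \<in> G \<rightarrow>\<^sub>M uniforms_space"
      unfolding G_def by (rule measurable_vimage_algebra1) (auto simp: space_PiM all_uniforms_def)
    then have "(\<lambda>\<omega>. all_uniforms Ui \<omega> n) \<in> G \<rightarrow>\<^sub>M borel"
      by (rule measurable_compose) (use that in \<open>auto intro!: measurable_component_singleton\<close>)
    then show ?thesis
      using that by (simp add: all_uniforms_def)
  qed
  have indep_Y: "indep_vars (\<lambda>_. count_space UNIV) (\<lambda>n. Yi l n) {1..}"
  proof -
    have "indep_vars (\<lambda>_. obs_vec_space s) (obs_vec s Yi) {1..}"
      using model by (simp add: system_model_def)
    then have "indep_vars (\<lambda>_. count_space UNIV) (\<lambda>n \<omega>. obs_vec s Yi n \<omega> l) {1..}"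
      by (rule indep_vars_compose2) (rule measurable_component_singleton[OF l])
    then show ?thesis
      using l by (simp add: obs_vec_def)
  qed
  have indep_U: "indep_vars (\<lambda>_. borel) Ui {1..}"
    using model by (simp add: system_model_def)
  note Ym = system_measurable(1)[OF model l] and Um = system_measurable(2)[OF model]
  have pY: "prob (Yi l n -` {b} \<inter> space M) = pmf (bernoulli_pmf (q l)) b" if "n \<ge> 1" for n b
  proof -
    have "distr M (count_space UNIV) (Yi l n) = measure_pmf (bernoulli_pmf (q l))"
      using model l that by (simp add: system_model_def)
    then show ?thesis
      using measure_distr[OF Ym[OF that], of "{b}"] by (simp add: measure_pmf_single)
  qed
  have pU: "prob (Ui n -` {..h} \<inter> space M) = h" if "n \<ge> 1" for n
  proof -
    have "distr M borel (Ui n) = uniform_measure lborel {0<..<1}"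
      using model that by (simp add: system_model_def)
    then show ?thesis
      using measure_distr[OF Um[OF that], of "{..h}"] measure_uniform_atMost[OF h] by simp
  qed
  have pU': "prob (Ui n -` {h<..} \<inter> space M) = 1 - h" if "n \<ge> 1" for n
  proof -
    have "Ui n -` {h<..} \<inter> space M = space M - (Ui n -` {..h} \<inter> space M)" by auto
    then show ?thesis
      using prob_compl[OF measurable_sets[OF Um[OF that], of "{..h}"]] pU[OF that] by simp
  qed
  have joint: "prob ((Yi l n -` {b} \<inter> space M) \<inter> (Ui n -` B \<inter> space M)) =
      prob (Yi l n -` {b} \<inter> space M) * prob (Ui n -` B \<inter> space M)"
    if "n \<ge> 1" "B \<in> sets borel" for n b B
    using measurable_sets[OF YF[OF that(1)], of "{b}"] measurable_sets[OF UG[OF that(1)] that(2)]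
    by (intro indep_setD[OF FG(1)]) (auto simp: FG)
  show ?thesis
  proof
    have "indep_vars (\<lambda>_. count_space UNIV \<Otimes>\<^sub>M borel) (\<lambda>n \<omega>. (Yi l n \<omega>, Ui n \<omega>)) {1..}"
      using YF UG by (intro indep_vars_Pair_of_indep_families[OF indep_Y indep_U FG]) auto
    then have "indep_vars (\<lambda>_. count_space UNIV)
        (\<lambda>n \<omega>. (\<lambda>(y, u). of_bool y - dummy u h) (Yi l n \<omega>, Ui n \<omega>)) {1..}"
    proof (rule indep_vars_compose2)
      have "(\<lambda>x. of_bool (fst x) - dummy (snd x) h)
          \<in> (count_space UNIV \<Otimes>\<^sub>M borel) \<rightarrow>\<^sub>M count_space UNIV"
        by (rule measurable_countable_binop[OF measurable_fst
            measurable_compose[OF measurable_snd measurable_dummy], of "\<lambda>y d. of_bool y - d"])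
      then show "(\<lambda>(y, u). of_bool y - dummy u h)
          \<in> (count_space UNIV \<Otimes>\<^sub>M borel) \<rightarrow>\<^sub>M count_space UNIV"
        by (simp add: case_prod_beta')
    qed
    then show "indep_vars (\<lambda>_. count_space UNIV) (\<lambda>n \<omega>. of_bool (Yi l n \<omega>) - dummy (Ui n \<omega>) h) {1..}"
      by simp
    show "of_bool (Yi l n \<omega>) - dummy (Ui n \<omega>) h \<in> {-1, 0, 1}" for n \<omega>
      by (auto simp: dummy_def)
    fix n :: nat assume n: "n \<ge> 1"
    have "{\<omega> \<in> space M. of_bool (Yi l n \<omega>) - dummy (Ui n \<omega>) h = 1} =
        (Yi l n -` {True} \<inter> space M) \<inter> (Ui n -` {h<..} \<inter> space M)"
      by (auto simp: dummy_def of_bool_def split: if_splits)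
    then show "prob {\<omega> \<in> space M. of_bool (Yi l n \<omega>) - dummy (Ui n \<omega>) h = 1} = q l * (1 - h)"
      using joint[OF n, of "{h<..}" True] pY[OF n] pU'[OF n] q by simp
    have "{\<omega> \<in> space M. of_bool (Yi l n \<omega>) - dummy (Ui n \<omega>) h = -1} =
        (Yi l n -` {False} \<inter> space M) \<inter> (Ui n -` {..h} \<inter> space M)"
      by (auto simp: dummy_def of_bool_def split: if_splits)
    then show "prob {\<omega> \<in> space M. of_bool (Yi l n \<omega>) - dummy (Ui n \<omega>) h = -1} = (1 - q l) * h"
      using joint[OF n, of "{..h}" False] pY[OF n] pU[OF n] q by simp
  qed
qed

section \<open>Correct decisions over all thresholds of a constraint\<close>

text \<open>The event \<open>CD\<close> as a condition on paths. Separating it from the sample space allows the same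
  condition to be read on the space of observation sequences, where independence of the systems
  is stated.\<close>

definition correct :: "real \<Rightarrow> nat \<Rightarrow> real \<Rightarrow> (nat \<Rightarrow> bool) \<Rightarrow> (nat \<Rightarrow> real) \<Rightarrow> real \<Rightarrow> bool" where
  "correct \<theta> H p y u h \<longleftrightarrow>
     (if desirable \<theta> p h then declared_feasible H (walk y u h)
      else unacceptable \<theta> p h \<longrightarrow> declared_infeasible H (walk y u h))"

lemma CD_eq_correct:
  "CD M \<theta> H p Yil Ui h = {\<omega> \<in> space M. correct \<theta> H p (\<lambda>n. Yil n \<omega>) (\<lambda>n. Ui n \<omega>) h}"
  by (auto simp: CD_def correct_def)

text \<open>All thresholds share the same uniforms, so a larger threshold gives more dummy successes.
  This coupling keeps the error from growing with the number of thresholds.\<close>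

lemma walk_antimono: "h \<le> h' \<Longrightarrow> walk y u h' r \<le> walk y u h r"
  unfolding walk_def by (intro sum_mono) (auto simp: dummy_def)

text \<open>By monotonicity in the threshold, a correct decision for the smallest desirable threshold
  forces a correct one for every desirable threshold, and likewise for the largest unacceptable
  threshold. So at most two thresholds per constraint can contribute to the error, which is why the
  allocations count \<open>min (card (T l)) 2\<close>.\<close>

lemma two_thresholds_decide:
  assumes "finite T"
  obtains R where "R \<subseteq> T" "card R \<le> min (card T) 2"
    "\<And>y u. \<forall>h\<in>R. correct \<theta> H p y u h \<Longrightarrow> \<forall>h\<in>T. correct \<theta> H p y u h"
proof
  let ?D = "{h\<in>T. desirable \<theta> p h}" and ?U = "{h\<in>T. \<not> desirable \<theta> p h \<and> unacceptable \<theta> p h}"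
  define R where "R = (if ?D = {} then {} else {Min ?D}) \<union> (if ?U = {} then {} else {Max ?U})"
  have fin: "finite ?D" "finite ?U" using assms by auto
  show "R \<subseteq> T"
    unfolding R_def using Min_in[OF fin(1)] Max_in[OF fin(2)] by auto
  then have "card R \<le> card T" by (rule card_mono[OF assms])
  moreover have "card R \<le> 2"
    unfolding R_def by (auto simp: card_insert_if)
  ultimately show "card R \<le> min (card T) 2" by simp
  fix y u assume R: "\<forall>h\<in>R. correct \<theta> H p y u h"
  show "\<forall>h\<in>T. correct \<theta> H p y u h"
  proof
    fix h assume "h \<in> T"
    consider "h \<in> ?D" | "h \<in> ?U" | "\<not> desirable \<theta> p h" "\<not> unacceptable \<theta> p h"
      using \<open>h \<in> T\<close> by auto
    then show "correct \<theta> H p y u h"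
    proof cases
      case 1
      then have "Min ?D \<in> R" and le: "Min ?D \<le> h" and "Min ?D \<in> ?D"
        using Min_in[OF fin(1)] fin by (auto simp: R_def)
      then have "declared_feasible H (walk y u (Min ?D))"
        using R unfolding correct_def by auto
      then have "declared_feasible H (walk y u h)"
        using walk_antimono[OF le] by (rule declared_feasible_mono)
      then show ?thesis using 1 by (simp add: correct_def)
    next
      case 2
      then have "Max ?U \<in> R" and le: "h \<le> Max ?U" and "Max ?U \<in> ?U"
        using Max_in[OF fin(2)] fin by (auto simp: R_def)
      then have "declared_infeasible H (walk y u (Max ?U))"
        using R unfolding correct_def by auto
      then have "declared_infeasible H (walk y u h)"
        using walk_antimono[OF le] by (rule declared_infeasible_mono)
      then show ?thesis using 2 by (simp add: correct_def)
    next
      case 3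
      then show ?thesis by (simp add: correct_def)
    qed
  qed
qed

lemma (in prob_space) prob_correct_ge:
  assumes model: "system_model M s q Yi Ui" and l: "l \<in> {1..s}" and h: "0 < h" "h < 1"
    and q: "0 < q l" "q l < 1" and "\<theta> > 1" and "H > 0"
  shows "prob {\<omega> \<in> space M. correct \<theta> H (q l) (\<lambda>n. Yi l n \<omega>) (\<lambda>n. Ui n \<omega>) h} \<ge> 1 - 1 / (1 + \<theta> ^ H)"
proof -
  let ?X = "\<lambda>n \<omega>. of_bool (Yi l n \<omega>) - dummy (Ui n \<omega>) h"
  let ?a = "q l * (1 - h)" and ?b = "(1 - q l) * h"
  have pos: "?a > 0" "?b > 0" using h q by auto
  have walk: "lazy_random_walk M ?X ?a ?b"
    using lazy_random_walk_system[where h = h, OF model l h q] .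
  consider "desirable \<theta> (q l) h" | "\<not> desirable \<theta> (q l) h" "unacceptable \<theta> (q l) h"
    | "\<not> desirable \<theta> (q l) h" "\<not> unacceptable \<theta> (q l) h"
    by auto
  then show ?thesis
  proof cases
    case 1
    then have "\<theta> * ?a \<le> ?b"
      using pos by (simp add: desirable_def pos_le_divide_eq)
    from lazy_random_walk.prob_declared_feasible_ge[OF walk pos(1) \<open>\<theta> > 1\<close> this \<open>H > 0\<close>]
    show ?thesis
      using 1 by (simp add: correct_def walk_def[abs_def])
  next
    case 2
    then have "\<theta> * ?b \<le> ?a"
      using pos by (simp add: unacceptable_def pos_le_divide_eq)
    from lazy_random_walk.prob_declared_feasible_ge[OF lazy_random_walk_uminus[OF walk]
        pos(2) \<open>\<theta> > 1\<close> this \<open>H > 0\<close>]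
    show ?thesis
      using 2 unfolding sum_negf
      by (simp add: correct_def walk_def[abs_def] declared_infeasible_iff_feasible_uminus)
  next
    case 3
    then show ?thesis
      using \<open>\<theta> > 1\<close> by (simp add: correct_def prob_space add_pos_pos)
  qed
qed

section \<open>From thresholds to systems\<close>

text \<open>A system and its image in the canonical sequence spaces agree from time 1 on; this transfers
  walks between the two.\<close>

lemma walk_cong:
  assumes "\<And>n. n \<ge> 1 \<Longrightarrow> y n = y' n" "\<And>n. n \<ge> 1 \<Longrightarrow> u n = u' n"
  shows "walk y u h = walk y' u' h"
  unfolding walk_def using assms by (intro ext sum.cong) auto

lemma pred_correct:
  assumes "\<And>n. n \<ge> 1 \<Longrightarrow> (\<lambda>x. y x n) \<in> N \<rightarrow>\<^sub>M count_space UNIV"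
    and "\<And>n. n \<ge> 1 \<Longrightarrow> (\<lambda>x. u x n) \<in> N \<rightarrow>\<^sub>M borel"
  shows "Measurable.pred N (\<lambda>x. correct \<theta> H p (y x) (u x) h)"
proof -
  have walk: "(\<lambda>x. walk (y x) (u x) h r) \<in> N \<rightarrow>\<^sub>M count_space UNIV" for r
  proof (induction r)
    case 0
    then show ?case by (simp add: walk_def)
  next
    case (Suc r)
    have eq: "(\<lambda>x. walk (y x) (u x) h (Suc r)) =
        (\<lambda>x. walk (y x) (u x) h r + (of_bool (y x (Suc r)) - dummy (u x (Suc r)) h))"
      by (simp add: walk_def)
    have "(\<lambda>x. y x (Suc r)) \<in> N \<rightarrow>\<^sub>M count_space UNIV"
      by (rule assms(1)) simp
    moreover have "(\<lambda>x. dummy (u x (Suc r)) h) \<in> N \<rightarrow>\<^sub>M count_space UNIV"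
      by (rule measurable_compose[OF assms(2) measurable_dummy]) simp
    ultimately have "(\<lambda>x. of_bool (y x (Suc r)) - dummy (u x (Suc r)) h) \<in> N \<rightarrow>\<^sub>M count_space UNIV"
      by (rule measurable_countable_binop[of _ _ _ "\<lambda>y d. of_bool y - d"])
    then show ?case
      unfolding eq by (rule measurable_countable_binop[OF Suc])
  qed
  have "(\<lambda>x. - walk (y x) (u x) h r) \<in> N \<rightarrow>\<^sub>M count_space UNIV" for r
    by (rule measurable_compose[OF walk]) simp
  note * = pred_declared_feasible[of "\<lambda>x. walk (y x) (u x) h" N H, OF walk]
    pred_declared_feasible[of "\<lambda>x r. - walk (y x) (u x) h r" N H, OF this]
  show ?thesis
    using * unfolding correct_def declared_infeasible_iff_feasible_uminus
    by (cases "desirable \<theta> p h"; cases "unacceptable \<theta> p h") simp_all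
qed

text \<open>The minimum in the definition of \<open>boundary\<close> is attained because the powers of \<open>\<theta>\<close> are
  unbounded.\<close>

lemma boundary_works:
  assumes "b > 0" and "\<theta> > 1"
  shows "boundary b \<theta> > 0" "1 / (1 + \<theta> ^ boundary b \<theta>) \<le> b"
proof -
  obtain n where n: "1 / b < \<theta> ^ n"
    using real_arch_pow[OF \<open>\<theta> > 1\<close>] by blast
  have "\<theta> ^ n \<le> \<theta> ^ Suc n"
    using \<open>\<theta> > 1\<close> by (intro power_increasing) auto
  with n have "1 / b < 1 + \<theta> ^ Suc n" by linarith
  then have "b \<ge> 1 / (1 + \<theta> ^ Suc n)"
    using \<open>b > 0\<close> \<open>\<theta> > 1\<close> by (simp add: field_simps add_pos_pos)
  then have "Suc n > 0 \<and> b \<ge> 1 / (1 + \<theta> ^ Suc n)" by simp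
  from LeastI[of "\<lambda>H. H > 0 \<and> b \<ge> 1 / (1 + \<theta> ^ H)", OF this]
  show "boundary b \<theta> > 0" "1 / (1 + \<theta> ^ boundary b \<theta>) \<le> b"
    unfolding boundary_def by auto
qed

text \<open>Both allocations split \<open>\<beta>\<close> so that the constraints together, each charged for at most two
  thresholds, use up no more than \<open>\<beta>\<close>. If there is no threshold at all, the proportional
  allocation divides by zero, but then every summand vanishes.\<close>

lemma allocation_sum_le:
  assumes "\<beta> \<ge> 0" and "s \<ge> 1"
    and "equal_allocation s T \<beta> \<beta>l \<or> proportional_allocation s T \<beta> \<beta>l"
  shows "(\<Sum>l=1..s. real (min (card (T l)) 2) * \<beta>l l) \<le> \<beta>"
  using assms(3)
proof
  assume eq: "equal_allocation s T \<beta> \<beta>l"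
  have "(\<Sum>l=1..s. real (min (card (T l)) 2) * \<beta>l l) \<le> (\<Sum>l=1..s. \<beta> / real s)"
  proof (rule sum_mono)
    fix l assume "l \<in> {1..s}"
    then have one: "card (T l) = 1 \<Longrightarrow> \<beta>l l = \<beta> / real s"
      and more: "card (T l) > 1 \<Longrightarrow> \<beta>l l = \<beta> / (2 * real s)"
      using eq unfolding equal_allocation_def by blast+
    consider "card (T l) = 0" | "card (T l) = 1" | "card (T l) > 1" by linarith
    then show "real (min (card (T l)) 2) * \<beta>l l \<le> \<beta> / real s"
    proof cases
      case 1
      then show ?thesis using assms(1) by simp
    next
      case 2
      then show ?thesis using one by simp
    next
      case 3
      then have "min (card (T l)) 2 = 2" by simp
      then show ?thesis using more[OF 3] by simp
    qed
  qed
  then show ?thesis using assms(2) by simp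
next
  assume proportional: "proportional_allocation s T \<beta> \<beta>l"
  define D where "D = (\<Sum>m=1..s. min (card (T m)) 2)"
  have "(\<Sum>l=1..s. real (min (card (T l)) 2) * \<beta>l l) =
      (\<Sum>l=1..s. real (min (card (T l)) 2) * (\<beta> / real D))"
  proof (rule sum.cong)
    fix l assume "l \<in> {1..s}"
    then have "card (T l) \<ge> 1 \<Longrightarrow> \<beta>l l = \<beta> / real D"
      using proportional unfolding proportional_allocation_def D_def by blast
    then show "real (min (card (T l)) 2) * \<beta>l l = real (min (card (T l)) 2) * (\<beta> / real D)"
      by (cases "card (T l) = 0") auto
  qed simp
  also have "\<dots> = real D * (\<beta> / real D)"
    unfolding D_def by (simp only: of_nat_sum sum_distrib_right)
  also have "\<dots> \<le> \<beta>" using assms(1) by (cases "D = 0") auto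
  finally show ?thesis .
qed

lemma allocation_pos:
  assumes "\<beta> > 0" and "l \<in> {1..s}" and "finite (T l)" "T l \<noteq> {}"
    and "equal_allocation s T \<beta> \<beta>l \<or> proportional_allocation s T \<beta> \<beta>l"
  shows "\<beta>l l > 0"
proof -
  have card: "card (T l) \<ge> 1" using assms(3,4) by (simp add: Suc_le_eq card_gt_0_iff)
  have "real s > 0" using assms(2) by simp
  have "(\<Sum>m=1..s. min (card (T m)) 2) \<ge> min (card (T l)) 2"
    using assms(2) by (intro member_le_sum) auto
  then have "(\<Sum>m=1..s. min (card (T m)) 2) > 0" using card by linarith
  then have D: "real (\<Sum>m=1..s. min (card (T m)) 2) > 0" by (simp only: of_nat_0_less_iff)
  from assms(5) show ?thesis
  proof
    assume "equal_allocation s T \<beta> \<beta>l"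
    then have "\<beta>l l = \<beta> / real s \<or> \<beta>l l = \<beta> / (2 * real s)"
      using card assms(2) unfolding equal_allocation_def by (metis le_neq_implies_less)
    then show ?thesis using \<open>real s > 0\<close> assms(1) by auto
  next
    assume "proportional_allocation s T \<beta> \<beta>l"
    then have "\<beta>l l = \<beta> / real (\<Sum>m=1..s. min (card (T m)) 2)"
      using card assms(2) unfolding proportional_allocation_def by blast
    then show ?thesis using D assms(1) by (metis divide_pos_pos)
  qed
qed

definition all_correct ::
  "nat \<Rightarrow> (nat \<Rightarrow> real set) \<Rightarrow> (nat \<Rightarrow> real) \<Rightarrow> (nat \<Rightarrow> nat) \<Rightarrow> (nat \<Rightarrow> real) \<Rightarrow>
   (nat \<Rightarrow> nat \<Rightarrow> bool) \<Rightarrow> (nat \<Rightarrow> real) \<Rightarrow> bool" where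
  "all_correct s T \<theta> H q y u \<longleftrightarrow> (\<forall>l\<in>{1..s}. \<forall>h\<in>T l. correct (\<theta> l) (H l) (q l) (y l) u h)"

lemma pred_all_correct:
  assumes "\<And>l. l \<in> {1..s} \<Longrightarrow> finite (T l)"
    and "\<And>l n. l \<in> {1..s} \<Longrightarrow> n \<ge> 1 \<Longrightarrow> (\<lambda>x. y x l n) \<in> N \<rightarrow>\<^sub>M count_space UNIV"
    and "\<And>n. n \<ge> 1 \<Longrightarrow> (\<lambda>x. u x n) \<in> N \<rightarrow>\<^sub>M borel"
  shows "Measurable.pred N (\<lambda>x. all_correct s T \<theta> H q (y x) (u x))"
  unfolding all_correct_def using assms
  by (intro pred_intros_finite pred_correct) auto

text \<open>Both the passage from thresholds to a constraint and the passage from constraints to the system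
  are union bounds, so the arbitrary dependence between the walks of one system does no harm.\<close>

lemma (in prob_space) prob_all_correct_ge:
  assumes model: "system_model M s q Yi Ui"
    and T: "\<And>l. l \<in> {1..s} \<Longrightarrow> finite (T l) \<and> T l \<subseteq> {0<..<1}"
    and q: "\<And>l. l \<in> {1..s} \<Longrightarrow> 0 < q l \<and> q l < 1"
    and \<theta>: "\<And>l. l \<in> {1..s} \<Longrightarrow> \<theta> l > 1"
    and H: "\<And>l. l \<in> {1..s} \<Longrightarrow> T l \<noteq> {} \<Longrightarrow> H l > 0 \<and> 1 / (1 + \<theta> l ^ H l) \<le> e l"
  shows "prob {\<omega> \<in> space M. all_correct s T \<theta> H q (\<lambda>l n. Yi l n \<omega>) (\<lambda>n. Ui n \<omega>)}
    \<ge> 1 - (\<Sum>l=1..s. real (min (card (T l)) 2) * e l)"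
  unfolding all_correct_def
proof (rule prob_Ball_ge)
  fix l assume l: "l \<in> {1..s}"
  let ?C = "\<lambda>h \<omega>. correct (\<theta> l) (H l) (q l) (\<lambda>n. Yi l n \<omega>) (\<lambda>n. Ui n \<omega>) h"
  have pred: "Measurable.pred M (?C h)" for h
    using system_measurable[OF model] l by (intro pred_correct) auto
  have events: "{\<omega> \<in> space M. \<forall>h\<in>S. ?C h \<omega>} \<in> events" if "S \<subseteq> T l" for S
    unfolding pred_def[symmetric] using pred T[OF l] finite_subset[OF that]
    by (intro pred_intros_finite) auto
  then show "{\<omega> \<in> space M. \<forall>h\<in>T l. ?C h \<omega>} \<in> events" by simp
  obtain R where R: "R \<subseteq> T l" "card R \<le> min (card (T l)) 2"
    "\<And>y u. \<forall>h\<in>R. correct (\<theta> l) (H l) (q l) y u h \<Longrightarrow> \<forall>h\<in>T l. correct (\<theta> l) (H l) (q l) y u h"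
    using two_thresholds_decide[of "T l" "\<theta> l" "H l" "q l"] T[OF l] by metis
  have "(\<Sum>h\<in>R. e l) \<le> real (min (card (T l)) 2) * e l"
  proof (cases "T l = {}")
    case True
    then show ?thesis using R(1) by simp
  next
    case False
    have "0 \<le> 1 / (1 + \<theta> l ^ H l)" using \<theta>[OF l] by simp
    with H[OF l False] have "0 \<le> e l" by linarith
    then show ?thesis using R(2) by (simp add: mult_right_mono)
  qed
  then have "1 - real (min (card (T l)) 2) * e l \<le> 1 - (\<Sum>h\<in>R. e l)" by simp
  also have "\<dots> \<le> prob {\<omega> \<in> space M. \<forall>h\<in>R. ?C h \<omega>}"
  proof (rule prob_Ball_ge)
    show "finite R" using R(1) T[OF l] finite_subset by auto
    fix h assume "h \<in> R"
    then have h: "h \<in> T l" using R(1) by auto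
    show "{\<omega> \<in> space M. ?C h \<omega>} \<in> events" using pred by (simp add: pred_def)
    have "1 - e l \<le> 1 - 1 / (1 + \<theta> l ^ H l)" using H[OF l] h by auto
    also have "\<dots> \<le> prob {\<omega> \<in> space M. ?C h \<omega>}"
      using T[OF l] h q[OF l] \<theta>[OF l] H[OF l]
      by (intro prob_correct_ge[OF model l]) auto
    finally show "1 - e l \<le> prob {\<omega> \<in> space M. ?C h \<omega>}" .
  qed
  also have "\<dots> \<le> prob {\<omega> \<in> space M. \<forall>h\<in>T l. ?C h \<omega>}"
    using R(3) by (intro finite_measure_mono events) auto
  finally show "1 - real (min (card (T l)) 2) * e l \<le> prob {\<omega> \<in> space M. \<forall>h\<in>T l. ?C h \<omega>}" .
qed simp

lemma PCD_eq:
  "PCD M k s T \<theta> H p Y U =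
    measure M {\<omega> \<in> space M. \<forall>i\<in>{1..k}. all_correct s T \<theta> H (p i) (\<lambda>l n. Y i l n \<omega>) (\<lambda>n. U i n \<omega>)}"
  unfolding PCD_def CD_eq_correct all_correct_def by (rule arg_cong[where f = "measure M"]) auto

text \<open>Whether all decisions for a system are correct is a measurable property of its sequences of
  observations and uniforms, so independence of these sequences across systems makes the
  probabilities multiply.\<close>

lemma (in prob_space) prob_all_correct_independent:
  fixes p :: "nat \<Rightarrow> nat \<Rightarrow> real" and \<theta> :: "nat \<Rightarrow> real" and H :: "nat \<Rightarrow> nat"
  assumes ind: "independent_systems M k s Y U" and "k \<ge> 1"
    and T: "\<And>l. l \<in> {1..s} \<Longrightarrow> finite (T l)"
  defines "C \<equiv> \<lambda>i \<omega>. all_correct s T \<theta> H (p i) (\<lambda>l n. Y i l n \<omega>) (\<lambda>n. U i n \<omega>)"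
  shows "prob {\<omega> \<in> space M. \<forall>i\<in>{1..k}. C i \<omega>} = (\<Prod>i=1..k. prob {\<omega> \<in> space M. C i \<omega>})"
proof -
  let ?N = "obs_space s \<Otimes>\<^sub>M uniforms_space"
  let ?V = "\<lambda>i \<omega>. (all_obs s (Y i) \<omega>, all_uniforms (U i) \<omega>)"
  define B where "B i = {x \<in> space ?N. all_correct s T \<theta> H (p i) (\<lambda>l n. fst x (l, n)) (snd x)}" for i
  have B: "B i \<in> sets ?N" for i
    unfolding B_def pred_def[symmetric]
  proof (rule pred_all_correct[OF T])
    show "(\<lambda>x. fst x (l, n)) \<in> ?N \<rightarrow>\<^sub>M count_space UNIV" if "l \<in> {1..s}" "n \<ge> 1" for l n
      using that
      by (intro measurable_compose[OF measurable_fst] measurable_component_singleton) auto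
    show "(\<lambda>x. snd x n) \<in> ?N \<rightarrow>\<^sub>M borel" if "n \<ge> 1" for n
      using that
      by (intro measurable_compose[OF measurable_snd] measurable_component_singleton) auto
  qed
  have cong: "all_correct s T \<theta> H (p i) (\<lambda>l n. all_obs s (Y i) \<omega> (l, n)) (all_uniforms (U i) \<omega>) \<longleftrightarrow> C i \<omega>"
    for i \<omega>
  proof -
    have "walk (\<lambda>n. all_obs s (Y i) \<omega> (l, n)) (all_uniforms (U i) \<omega>) h =
        walk (\<lambda>n. Y i l n \<omega>) (\<lambda>n. U i n \<omega>) h" if "l \<in> {1..s}" for l h
      using that by (intro walk_cong) (auto simp: all_obs_def all_uniforms_def)
    then show ?thesis
      unfolding C_def all_correct_def correct_def by auto
  qed
  have vimage: "?V i -` B i \<inter> space M = {\<omega> \<in> space M. C i \<omega>}" for i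
  proof -
    have "?V i \<omega> \<in> space ?N" for \<omega>
      by (simp add: space_pair_measure space_PiM all_obs_def all_uniforms_def)
    then show ?thesis
      unfolding B_def using cong by auto
  qed
  have "{\<omega> \<in> space M. \<forall>i\<in>{1..k}. C i \<omega>} = (\<Inter>i\<in>{1..k}. ?V i -` B i \<inter> space M)"
    unfolding vimage using \<open>k \<ge> 1\<close> by auto
  also have "prob \<dots> = (\<Prod>i=1..k. prob (?V i -` B i \<inter> space M))"
    using ind \<open>k \<ge> 1\<close> B unfolding independent_systems_def by (intro indep_varsD_finite) auto
  finally show ?thesis unfolding vimage .
qed

section \<open>The guarantee of the procedure\<close>

theorem corollary2:
  fixes M :: "'a measure"
    and k s :: nat
    and \<alpha> \<beta> :: real
    and \<theta> \<beta>l :: "nat \<Rightarrow> real"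
    and T :: "nat \<Rightarrow> real set"
    and p :: "nat \<Rightarrow> nat \<Rightarrow> real"
    and Y :: "nat \<Rightarrow> nat \<Rightarrow> nat \<Rightarrow> 'a \<Rightarrow> bool"
    and U :: "nat \<Rightarrow> nat \<Rightarrow> 'a \<Rightarrow> real"
  assumes "prob_space M"
    and "k \<ge> 2" and "s \<ge> 1"
    and "0 < \<alpha>" and "\<alpha> < 1"
    and "\<And>l. l \<in> {1..s} \<Longrightarrow> \<theta> l > 1"
    and "\<And>l. l \<in> {1..s} \<Longrightarrow> finite (T l) \<and> T l \<subseteq> {0<..<1}"
    and "\<And>i l. i \<in> {1..k} \<Longrightarrow> l \<in> {1..s} \<Longrightarrow> 0 < p i l \<and> p i l < 1"
    and "\<And>i. i \<in> {1..k} \<Longrightarrow> system_model M s (p i) (Y i) (U i)"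
    and sampling: "independent_systems M k s Y U \<and> \<beta> = 1 - (1 - \<alpha>) powr (1 / real k)
           \<or> \<beta> = \<alpha> / real k"
    and allocation: "equal_allocation s T \<beta> \<beta>l \<or> proportional_allocation s T \<beta> \<beta>l"
  shows "PCD M k s T \<theta> (\<lambda>l. boundary (\<beta>l l) (\<theta> l)) p Y U \<ge> 1 - \<alpha>"
proof -
  interpret prob_space M by fact
  let ?H = "\<lambda>l. boundary (\<beta>l l) (\<theta> l)"
  let ?C = "\<lambda>i \<omega>. all_correct s T \<theta> ?H (p i) (\<lambda>l n. Y i l n \<omega>) (\<lambda>n. U i n \<omega>)"
  have "(1 - \<alpha>) powr (1 / real k) < 1"
    using assms(2,4,5) powr_less_mono2[of "1 / real k" "1 - \<alpha>" 1] by simp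
  then have "\<beta> > 0"
    using sampling assms(2,4) by auto
  have system: "prob {\<omega> \<in> space M. ?C i \<omega>} \<ge> 1 - \<beta>" if i: "i \<in> {1..k}" for i
  proof -
    have "1 - \<beta> \<le> 1 - (\<Sum>l=1..s. real (min (card (T l)) 2) * \<beta>l l)"
      using allocation_sum_le[of \<beta> s T \<beta>l] \<open>\<beta> > 0\<close> assms(3) allocation by simp
    also have "\<dots> \<le> prob {\<omega> \<in> space M. ?C i \<omega>}"
    proof (rule prob_all_correct_ge[OF assms(9)[OF i] assms(7) assms(8)[OF i] assms(6)])
      fix l assume l: "l \<in> {1..s}" "T l \<noteq> {}"
      have "\<beta>l l > 0"
        using assms(7)[OF l(1)] l by (intro allocation_pos[OF \<open>\<beta> > 0\<close> _ _ _ allocation]) auto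
      then show "?H l > 0 \<and> 1 / (1 + \<theta> l ^ ?H l) \<le> \<beta>l l"
        using boundary_works[of "\<beta>l l" "\<theta> l"] assms(6)[OF l(1)] by simp
    qed
    finally show ?thesis .
  qed
  show ?thesis
    unfolding PCD_eq using sampling
  proof
    assume "\<beta> = \<alpha> / real k"
    then have "1 - \<alpha> = 1 - (\<Sum>i=1..k. \<beta>)"
      using assms(2) by simp
    also have "\<dots> \<le> prob {\<omega> \<in> space M. \<forall>i\<in>{1..k}. ?C i \<omega>}"
    proof (rule prob_Ball_ge)
      fix i assume i: "i \<in> {1..k}"
      show "{\<omega> \<in> space M. ?C i \<omega>} \<in> events"
        unfolding pred_def[symmetric] using assms(7) system_measurable[OF assms(9)[OF i]]
        by (intro pred_all_correct) auto
    qed (use system in auto)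
    finally show "1 - \<alpha> \<le> prob {\<omega> \<in> space M. \<forall>i\<in>{1..k}. ?C i \<omega>}" .
  next
    assume "independent_systems M k s Y U \<and> \<beta> = 1 - (1 - \<alpha>) powr (1 / real k)"
    then have ind: "independent_systems M k s Y U" and \<beta>: "1 - \<beta> = (1 - \<alpha>) powr (1 / real k)"
      by auto
    have "1 - \<alpha> = (\<Prod>i=1..k. 1 - \<beta>)"
      unfolding \<beta> using assms(2,5) by (simp add: powr_realpow[symmetric] powr_powr)
    also have "\<dots> \<le> (\<Prod>i=1..k. prob {\<omega> \<in> space M. ?C i \<omega>})"
      using system \<beta> by (intro prod_mono) auto
    also have "\<dots> = prob {\<omega> \<in> space M. \<forall>i\<in>{1..k}. ?C i \<omega>}"
      using ind assms(2,7) by (intro prob_all_correct_independent[symmetric]) auto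
    finally show "1 - \<alpha> \<le> prob {\<omega> \<in> space M. \<forall>i\<in>{1..k}. ?C i \<omega>}" .
  qed
qed

end
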